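(* The logic $\mathbf{IL}^-(\mathbf{J2}_+, \mathbf{J5})$ has the fixed point property: for any propositional variable $p$ and any formula $A(p)$ which is modalized in $p$, there exists a formula $F$ such that $v(F)\subseteq v(A)\setminus\{p\}$ and $\mathbf{IL}^-(\mathbf{J2}_+, \mathbf{J5}) \vdash F \leftrightarrow A(F)$.
   Context: Formulas are generated by $A ::= \bot \mid p \mid A \to A \mid \Box A \mid A \rhd A$, where $p$ ranges over a countably infinite set of propositional variables. The symbols $\neg,\land,\lor,\leftrightarrow,\top,\Diamond$ (with $\Diamond A := \neg\Box\neg A$) are the usual abbreviations. $\neg,\Box,\Diamond$ bind most strongly. $v(A)$ is the set of propositional variables contained in $A$. For a formula $A(p)$, $A(B)$ denotes the result of substituting $B$ for all occurrences of $p$ in $A(p)$. The logic $\mathbf{IL}^-$ has as axioms all instances of: $\mathbf{L1}$: all tautologies in this language; $\mathbf{L2}$: $\Box(A\to B)\to(\Box A\to\Box B)$; $\mathbf{L3}$: $\Box(\Box A\to A)\to\Box A$; $\mathbf{J3}$: $((A\rhd C)\land(B\rhd C))\to((A\lor B)\rhd C)$; $\mathbf{J6}$: $\Box A\leftrightarrow((\neg A)\rhd\bot)$. Its inference rules are Modus Ponens, Necessitation (from $A$ infer $\Box A$), $\mathbf{R1}$ (from $A\to B$ infer $(C\rhd A)\to(C\rhd B)$) and $\mathbf{R2}$ (from $A\to B$ infer $(B\rhd C)\to(A\rhd C)$). $\mathbf{IL}^-(\Sigma_1,\ldots,\Sigma_n)$ is the logic obtained from $\mathbf{IL}^-$ by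 adding the schemata $\Sigma_1,\ldots,\Sigma_n$ as axiom schemata (with the same rules). $\mathbf{J2}_+$ is the schema $((A\rhd(B\lor C))\land(B\rhd C))\to(A\rhd C)$ and $\mathbf{J5}$ is the schema $\Diamond A\rhd A$. $L\vdash A$ means that $A$ is a theorem of $L$. A formula $A$ is modalized in $p$ if every occurrence of $p$ in $A$ is in the scope of some modal operator $\Box$ or $\rhd$. *)

theory Defs
  imports Main
begin

datatype fm =
    Bot ("\<^bold>\<bottom>")
  | Var nat
  | Imp fm fm (infixr "\<^bold>\<longrightarrow>" 55)
  | Box fm ("\<^bold>\<box> _" [80] 80)
  | Rhd fm fm (infix "\<^bold>\<rhd>" 60)

abbreviation Neg :: "fm \<Rightarrow> fm" ("\<^bold>\<not> _" [80] 80) where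
  "\<^bold>\<not> A \<equiv> A \<^bold>\<longrightarrow> \<^bold>\<bottom>"

abbreviation Or :: "fm \<Rightarrow> fm \<Rightarrow> fm" (infixr "\<^bold>\<or>" 65) where
  "A \<^bold>\<or> B \<equiv> \<^bold>\<not> A \<^bold>\<longrightarrow> B"

abbreviation And :: "fm \<Rightarrow> fm \<Rightarrow> fm" (infixr "\<^bold>\<and>" 70) where
  "A \<^bold>\<and> B \<equiv> \<^bold>\<not> (A \<^bold>\<longrightarrow> \<^bold>\<not> B)"

abbreviation Iff :: "fm \<Rightarrow> fm \<Rightarrow> fm" (infix "\<^bold>\<longleftrightarrow>" 50) where
  "A \<^bold>\<longleftrightarrow> B \<equiv> (A \<^bold>\<longrightarrow> B) \<^bold>\<and> (B \<^bold>\<longrightarrow> A)"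

abbreviation Dia :: "fm \<Rightarrow> fm" ("\<^bold>\<diamond> _" [80] 80) where
  "\<^bold>\<diamond> A \<equiv> \<^bold>\<not> \<^bold>\<box> \<^bold>\<not> A"

primrec vars :: "fm \<Rightarrow> nat set" where
  "vars \<^bold>\<bottom> = {}"
| "vars (Var q) = {q}"
| "vars (A \<^bold>\<longrightarrow> B) = vars A \<union> vars B"
| "vars (\<^bold>\<box> A) = vars A"
| "vars (A \<^bold>\<rhd> B) = vars A \<union> vars B"

primrec subst :: "nat \<Rightarrow> fm \<Rightarrow> fm \<Rightarrow> fm" where
  "subst p F \<^bold>\<bottom> = \<^bold>\<bottom>"
| "subst p F (Var q) = (if q = p then F else Var q)"
| "subst p F (A \<^bold>\<longrightarrow> B) = subst p F A \<^bold>\<longrightarrow> subst p F B"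
| "subst p F (\<^bold>\<box> A) = \<^bold>\<box> (subst p F A)"
| "subst p F (A \<^bold>\<rhd> B) = subst p F A \<^bold>\<rhd> subst p F B"

primrec modalized :: "nat \<Rightarrow> fm \<Rightarrow> bool" where
  "modalized p \<^bold>\<bottom> = True"
| "modalized p (Var q) = (q \<noteq> p)"
| "modalized p (A \<^bold>\<longrightarrow> B) = (modalized p A \<and> modalized p B)"
| "modalized p (\<^bold>\<box> A) = True"
| "modalized p (A \<^bold>\<rhd> B) = True"

text \<open>In tautologies of the modal language the outermost modal subformulas
  act as propositional atoms: \<open>e\<close> assigns a truth value to every variable
  and every formula of the form \<open>\<^bold>\<box> A\<close> or \<open>A \<^bold>\<rhd> B\<close>.\<close>

primrec tval :: "(fm \<Rightarrow> bool) \<Rightarrow> fm \<Rightarrow> bool" where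
  "tval e \<^bold>\<bottom> = False"
| "tval e (Var q) = e (Var q)"
| "tval e (A \<^bold>\<longrightarrow> B) = (tval e A \<longrightarrow> tval e B)"
| "tval e (\<^bold>\<box> A) = e (\<^bold>\<box> A)"
| "tval e (A \<^bold>\<rhd> B) = e (A \<^bold>\<rhd> B)"

definition tautology :: "fm \<Rightarrow> bool" where
  "tautology A \<longleftrightarrow> (\<forall>e. tval e A)"

text \<open>\<open>ILm S\<close> is the set of theorems of the logic IL-minus extended by the formulas in \<open>S\<close>
  (all instances of the additional schemata) as axioms.\<close>

inductive_set ILm :: "fm set \<Rightarrow> fm set" for S :: "fm set" where
  Ax: "A \<in> S \<Longrightarrow> A \<in> ILm S"
| L1: "tautology A \<Longrightarrow> A \<in> ILm S"
| L2: "\<^bold>\<box> (A \<^bold>\<longrightarrow> B) \<^bold>\<longrightarrow> (\<^bold>\<box> A \<^bold>\<longrightarrow> \<^bold>\<box> B) \<in> ILm S"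
| L3: "\<^bold>\<box> (\<^bold>\<box> A \<^bold>\<longrightarrow> A) \<^bold>\<longrightarrow> \<^bold>\<box> A \<in> ILm S"
| J3: "((A \<^bold>\<rhd> C) \<^bold>\<and> (B \<^bold>\<rhd> C)) \<^bold>\<longrightarrow> ((A \<^bold>\<or> B) \<^bold>\<rhd> C) \<in> ILm S"
| J6: "(\<^bold>\<box> A \<^bold>\<longleftrightarrow> ((\<^bold>\<not> A) \<^bold>\<rhd> \<^bold>\<bottom>)) \<in> ILm S"
| MP: "A \<^bold>\<longrightarrow> B \<in> ILm S \<Longrightarrow> A \<in> ILm S \<Longrightarrow> B \<in> ILm S"
| Nec: "A \<in> ILm S \<Longrightarrow> \<^bold>\<box> A \<in> ILm S"
| R1: "A \<^bold>\<longrightarrow> B \<in> ILm S \<Longrightarrow> (C \<^bold>\<rhd> A) \<^bold>\<longrightarrow> (C \<^bold>\<rhd> B) \<in> ILm S"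
| R2: "A \<^bold>\<longrightarrow> B \<in> ILm S \<Longrightarrow> (B \<^bold>\<rhd> C) \<^bold>\<longrightarrow> (A \<^bold>\<rhd> C) \<in> ILm S"

definition J2_plus :: "fm set" where
  "J2_plus = {((A \<^bold>\<rhd> (B \<^bold>\<or> C)) \<^bold>\<and> (B \<^bold>\<rhd> C)) \<^bold>\<longrightarrow> (A \<^bold>\<rhd> C) | A B C. True}"

definition J5 :: "fm set" where
  "J5 = {\<^bold>\<diamond> A \<^bold>\<rhd> A | A. True}"

end

(* The de Jongh--Visser fixed point of A(p) \<rhd> B(p), namely
   D = A(\<top>) \<rhd> B(\<box>\<not>A(\<top>)), still works without the axiom J1.  The key point is that
   C \<rhd> A and A \<rhd> C depend only on the "last" A-points: by Loeb's axiom, J2+ and J5, A may be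
   replaced by A \<and> \<box>\<not>A on either side of \<rhd>.  So two formulas that are equivalent under \<box>\<not>A
   are interchangeable there.  Now \<box>\<not>A(\<top>) implies D, so D may be replaced by \<top> in A, and
   \<box>\<not>B(\<box>\<not>A(\<top>)) makes D equivalent to \<box>\<not>A(\<top>), so these two are interchangeable in B.

   An arbitrary formula modalized in p is a Boolean combination of modal formulas, and these
   are eliminated one at a time: to solve p = A'(p, M(p)), solve p = A'(p, q) by some F(q),
   then solve q = M(F(q)) by some G, and take F(G). *)

theory Submission
  imports Defs
begin

section \<open>Derived rules\<close>

lemma ILm_taut1:
  assumes "A \<in> ILm S" "\<And>e. tval e A \<Longrightarrow> tval e C"
  shows "C \<in> ILm S"
proof -
  have "A \<^bold>\<longrightarrow> C \<in> ILm S" using assms(2) by (intro ILm.L1) (simp add: tautology_def)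
  then show ?thesis using assms(1) ILm.MP by blast
qed

lemma ILm_taut2:
  assumes "A \<in> ILm S" "B \<in> ILm S" "\<And>e. tval e A \<Longrightarrow> tval e B \<Longrightarrow> tval e C"
  shows "C \<in> ILm S"
proof -
  have "B \<^bold>\<longrightarrow> C \<in> ILm S" by (rule ILm_taut1[OF assms(1)]) (simp add: assms(3))
  then show ?thesis using assms(2) ILm.MP by blast
qed

lemma ILm_taut3:
  assumes "A \<in> ILm S" "B \<in> ILm S" "C \<in> ILm S"
    "\<And>e. tval e A \<Longrightarrow> tval e B \<Longrightarrow> tval e C \<Longrightarrow> tval e D"
  shows "D \<in> ILm S"
proof -
  have "C \<^bold>\<longrightarrow> D \<in> ILm S" by (rule ILm_taut2[OF assms(1,2)]) (simp add: assms(4))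
  then show ?thesis using assms(3) ILm.MP by blast
qed

lemma ILm_taut4:
  assumes "A \<in> ILm S" "B \<in> ILm S" "C \<in> ILm S" "D \<in> ILm S"
    "\<And>e. tval e A \<Longrightarrow> tval e B \<Longrightarrow> tval e C \<Longrightarrow> tval e D \<Longrightarrow> tval e E"
  shows "E \<in> ILm S"
proof -
  have "D \<^bold>\<longrightarrow> E \<in> ILm S" by (rule ILm_taut3[OF assms(1-3)]) (simp add: assms(5))
  then show ?thesis using assms(4) ILm.MP by blast
qed

lemma Box_mono:
  assumes "A \<^bold>\<longrightarrow> B \<in> ILm S"
  shows "\<^bold>\<box> A \<^bold>\<longrightarrow> \<^bold>\<box> B \<in> ILm S"
  using ILm.L2 ILm.Nec[OF assms] by (rule ILm.MP)

lemma Box_mono2: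
  assumes "A \<^bold>\<longrightarrow> B \<^bold>\<longrightarrow> C \<in> ILm S"
  shows "\<^bold>\<box> A \<^bold>\<longrightarrow> \<^bold>\<box> B \<^bold>\<longrightarrow> \<^bold>\<box> C \<in> ILm S"
  by (rule ILm_taut2[OF Box_mono[OF assms] ILm.L2[of B C]]) simp

lemma Loeb_rule:
  assumes "A \<^bold>\<longrightarrow> \<^bold>\<box> B \<^bold>\<longrightarrow> B \<in> ILm S"
  shows "\<^bold>\<box> A \<^bold>\<longrightarrow> \<^bold>\<box> B \<in> ILm S"
  by (rule ILm_taut2[OF Box_mono[OF assms] ILm.L3[of B]]) simp

text \<open>Transitivity comes from Loeb's axiom applied to \<open>A \<and> \<box>A\<close>: since
  \<open>\<box>(A \<and> \<box>A)\<close> implies \<open>\<box>A\<close>, the premise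
  \<open>A\<close> suffices for the hypothesis of \<open>Loeb_rule\<close>.\<close>

lemma Box_4: "\<^bold>\<box> A \<^bold>\<longrightarrow> \<^bold>\<box> \<^bold>\<box> A \<in> ILm S"
proof -
  let ?B = "A \<^bold>\<and> \<^bold>\<box> A"
  have "\<^bold>\<box> ?B \<^bold>\<longrightarrow> \<^bold>\<box> A \<in> ILm S"
    by (intro Box_mono ILm.L1) (simp add: tautology_def)
  then have "A \<^bold>\<longrightarrow> \<^bold>\<box> ?B \<^bold>\<longrightarrow> ?B \<in> ILm S" by (rule ILm_taut1) simp
  then have 1: "\<^bold>\<box> A \<^bold>\<longrightarrow> \<^bold>\<box> ?B \<in> ILm S" by (rule Loeb_rule)
  have 2: "\<^bold>\<box> ?B \<^bold>\<longrightarrow> \<^bold>\<box> \<^bold>\<box> A \<in> ILm S"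
    by (intro Box_mono ILm.L1) (simp add: tautology_def)
  show ?thesis by (rule ILm_taut2[OF 1 2]) simp
qed

lemma Box_lift:
  assumes "\<^bold>\<box> A \<^bold>\<longrightarrow> B \<in> ILm S"
  shows "\<^bold>\<box> A \<^bold>\<longrightarrow> \<^bold>\<box> B \<in> ILm S"
  by (rule ILm_taut2[OF Box_4[of A] Box_mono[OF assms]]) simp

text \<open>By J6 a boxed formula says that its negation \<rhd>-reaches falsum, and R1 weakens
  falsum to any \<open>C\<close>.\<close>

lemma Box_imp_Neg_Rhd: "\<^bold>\<box> (A \<^bold>\<longrightarrow> B) \<^bold>\<longrightarrow> (\<^bold>\<not> (A \<^bold>\<longrightarrow> B) \<^bold>\<rhd> C) \<in> ILm S"
proof -
  have "\<^bold>\<bottom> \<^bold>\<longrightarrow> C \<in> ILm S" by (rule ILm.L1) (simp add: tautology_def)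
  then have 1: "(\<^bold>\<not> (A \<^bold>\<longrightarrow> B) \<^bold>\<rhd> \<^bold>\<bottom>) \<^bold>\<longrightarrow> (\<^bold>\<not> (A \<^bold>\<longrightarrow> B) \<^bold>\<rhd> C) \<in> ILm S"
    by (rule ILm.R1)
  show ?thesis by (rule ILm_taut2[OF 1 ILm.J6[of "A \<^bold>\<longrightarrow> B"]]) simp
qed

text \<open>This internalizes R2. \<open>A\<close> is covered by \<open>B\<close> and the
  exceptional part \<open>\<not>(A \<longrightarrow> B)\<close>; the box disposes of the latter, and
  J3 joins the two.\<close>

lemma Rhd_left_Box: "\<^bold>\<box> (A \<^bold>\<longrightarrow> B) \<^bold>\<longrightarrow> (B \<^bold>\<rhd> C) \<^bold>\<longrightarrow> (A \<^bold>\<rhd> C) \<in> ILm S"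
proof -
  have "A \<^bold>\<longrightarrow> B \<^bold>\<or> \<^bold>\<not> (A \<^bold>\<longrightarrow> B) \<in> ILm S" by (rule ILm.L1) (simp add: tautology_def)
  then have 1: "(B \<^bold>\<or> \<^bold>\<not> (A \<^bold>\<longrightarrow> B) \<^bold>\<rhd> C) \<^bold>\<longrightarrow> (A \<^bold>\<rhd> C) \<in> ILm S" by (rule ILm.R2)
  show ?thesis
    by (rule ILm_taut3[OF 1 Box_imp_Neg_Rhd[of A B C] ILm.J3[of B C "\<^bold>\<not> (A \<^bold>\<longrightarrow> B)"]]) simp
qed

section \<open>Consequences of J2+ and J5\<close>

abbreviation L :: "fm set" where
  "L \<equiv> ILm (J2_plus \<union> J5)"

lemma J2_plus_L: "(A \<^bold>\<rhd> (B \<^bold>\<or> C)) \<^bold>\<and> (B \<^bold>\<rhd> C) \<^bold>\<longrightarrow> (A \<^bold>\<rhd> C) \<in> L"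
  by (rule ILm.Ax) (auto simp: J2_plus_def)

lemma J5_L: "\<^bold>\<diamond> A \<^bold>\<rhd> A \<in> L"
  by (rule ILm.Ax) (auto simp: J5_def)

text \<open>This internalizes R1. The exceptional part \<open>\<not>(A \<longrightarrow> B)\<close>
  now appears as a disjunct on the right, where J2+ absorbs it into \<open>B\<close>.\<close>

lemma Rhd_right_Box: "\<^bold>\<box> (A \<^bold>\<longrightarrow> B) \<^bold>\<longrightarrow> (C \<^bold>\<rhd> A) \<^bold>\<longrightarrow> (C \<^bold>\<rhd> B) \<in> L"
proof -
  have "A \<^bold>\<longrightarrow> \<^bold>\<not> (A \<^bold>\<longrightarrow> B) \<^bold>\<or> B \<in> L" by (rule ILm.L1) (simp add: tautology_def)
  then have 1: "(C \<^bold>\<rhd> A) \<^bold>\<longrightarrow> (C \<^bold>\<rhd> \<^bold>\<not> (A \<^bold>\<longrightarrow> B) \<^bold>\<or> B) \<in> L" by (rule ILm.R1)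
  show ?thesis
    by (rule ILm_taut3[OF 1 Box_imp_Neg_Rhd[of A B B] J2_plus_L[of C "\<^bold>\<not> (A \<^bold>\<longrightarrow> B)" B]]) simp
qed

lemma Rhd_trans: "(A \<^bold>\<rhd> B) \<^bold>\<longrightarrow> (B \<^bold>\<rhd> C) \<^bold>\<longrightarrow> (A \<^bold>\<rhd> C) \<in> L"
proof -
  have "B \<^bold>\<longrightarrow> B \<^bold>\<or> C \<in> L" by (rule ILm.L1) (simp add: tautology_def)
  then have 1: "(A \<^bold>\<rhd> B) \<^bold>\<longrightarrow> (A \<^bold>\<rhd> B \<^bold>\<or> C) \<in> L" by (rule ILm.R1)
  show ?thesis by (rule ILm_taut2[OF 1 J2_plus_L[of A B C]]) simp
qed

section \<open>Interchangeability under \<open>\<rhd>\<close>\<close>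

text \<open>Contrapositive of Loeb's axiom for \<open>\<not>A\<close>: if no last
  \<open>A\<close>-point lies ahead, then no \<open>A\<close>-point lies ahead, so the present one
  is last.\<close>

lemma imp_last_or_Dia_last:
  "A \<^bold>\<longrightarrow> \<^bold>\<diamond> (A \<^bold>\<and> \<^bold>\<box> \<^bold>\<not> A) \<^bold>\<or> (A \<^bold>\<and> \<^bold>\<box> \<^bold>\<not> A) \<in> ILm S"
proof -
  have "\<^bold>\<not> (A \<^bold>\<and> \<^bold>\<box> \<^bold>\<not> A) \<^bold>\<longrightarrow> \<^bold>\<box> \<^bold>\<not> A \<^bold>\<longrightarrow> \<^bold>\<not> A \<in> ILm S"
    by (rule ILm.L1) (auto simp: tautology_def)
  then have "\<^bold>\<box> \<^bold>\<not> (A \<^bold>\<and> \<^bold>\<box> \<^bold>\<not> A) \<^bold>\<longrightarrow> \<^bold>\<box> \<^bold>\<not> A \<in> ILm S" by (rule Loeb_rule)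
  then show ?thesis by (rule ILm_taut1) auto
qed

text \<open>J5 and transitivity extend \<open>?B \<rhd> C\<close> to
  \<open>\<diamond>?B \<rhd> C\<close>; J3 combines both, and together they cover
  \<open>A\<close>.\<close>

lemma Rhd_left_last: "((A \<^bold>\<and> \<^bold>\<box> \<^bold>\<not> A \<^bold>\<rhd> C) \<^bold>\<longleftrightarrow> (A \<^bold>\<rhd> C)) \<in> L"
proof -
  let ?B = "A \<^bold>\<and> \<^bold>\<box> \<^bold>\<not> A"
  have 1: "(?B \<^bold>\<rhd> C) \<^bold>\<longrightarrow> (\<^bold>\<diamond> ?B \<^bold>\<rhd> C) \<in> L"
    by (rule ILm_taut2[OF Rhd_trans[of "\<^bold>\<diamond> ?B" ?B C] J5_L[of ?B]]) simp
  have 2: "(\<^bold>\<diamond> ?B \<^bold>\<or> ?B \<^bold>\<rhd> C) \<^bold>\<longrightarrow> (A \<^bold>\<rhd> C) \<in> L"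
    by (rule ILm.R2[OF imp_last_or_Dia_last])
  have 3: "(A \<^bold>\<rhd> C) \<^bold>\<longrightarrow> (?B \<^bold>\<rhd> C) \<in> L"
    by (intro ILm.R2 ILm.L1) (simp add: tautology_def)
  show ?thesis by (rule ILm_taut4[OF 1 2 3 ILm.J3[of "\<^bold>\<diamond> ?B" C ?B]]) simp
qed

text \<open>Weakening \<open>A\<close> on the right gives \<open>\<diamond>?B \<or> ?B\<close>. By
  J5, \<open>\<diamond>?B \<rhd> ?B\<close>, so J2+ removes the first disjunct.\<close>

lemma Rhd_right_last: "((C \<^bold>\<rhd> A \<^bold>\<and> \<^bold>\<box> \<^bold>\<not> A) \<^bold>\<longleftrightarrow> (C \<^bold>\<rhd> A)) \<in> L"
proof -
  let ?B = "A \<^bold>\<and> \<^bold>\<box> \<^bold>\<not> A"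
  have 1: "(C \<^bold>\<rhd> A) \<^bold>\<longrightarrow> (C \<^bold>\<rhd> \<^bold>\<diamond> ?B \<^bold>\<or> ?B) \<in> L"
    by (rule ILm.R1[OF imp_last_or_Dia_last])
  have 2: "(C \<^bold>\<rhd> ?B) \<^bold>\<longrightarrow> (C \<^bold>\<rhd> A) \<in> L"
    by (intro ILm.R1 ILm.L1) (simp add: tautology_def)
  show ?thesis
    by (rule ILm_taut4[OF 1 2 J5_L[of ?B] J2_plus_L[of C "\<^bold>\<diamond> ?B" ?B]]) simp
qed

text \<open>The assumption mentions only \<open>\<box>\<not>A\<close>, so the work is to show that
  \<open>\<box>\<not>A\<close> and \<open>\<box>\<not>B\<close> are equivalent. One direction lifts
  the assumption under the box; the other is Loeb's rule, as \<open>\<not>B\<close> and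
  \<open>\<box>\<not>A\<close> give \<open>\<not>A\<close>.\<close>

lemma last_cong:
  assumes "\<^bold>\<box> \<^bold>\<not> A \<^bold>\<longrightarrow> (A \<^bold>\<longleftrightarrow> B) \<in> ILm S"
  shows "(A \<^bold>\<and> \<^bold>\<box> \<^bold>\<not> A \<^bold>\<longleftrightarrow> B \<^bold>\<and> \<^bold>\<box> \<^bold>\<not> B) \<in> ILm S"
proof -
  have "\<^bold>\<not> A \<^bold>\<longrightarrow> (A \<^bold>\<longleftrightarrow> B) \<^bold>\<longrightarrow> \<^bold>\<not> B \<in> ILm S"
    by (rule ILm.L1) (simp add: tautology_def)
  then have 1: "\<^bold>\<box> \<^bold>\<not> A \<^bold>\<longrightarrow> \<^bold>\<box> \<^bold>\<not> B \<in> ILm S"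
    by (rule ILm_taut2[OF Box_mono2 Box_lift[OF assms]]) simp
  have "\<^bold>\<not> B \<^bold>\<longrightarrow> \<^bold>\<box> \<^bold>\<not> A \<^bold>\<longrightarrow> \<^bold>\<not> A \<in> ILm S"
    by (rule ILm_taut1[OF assms]) (unfold tval.simps, blast)
  then have 2: "\<^bold>\<box> \<^bold>\<not> B \<^bold>\<longrightarrow> \<^bold>\<box> \<^bold>\<not> A \<in> ILm S" by (rule Loeb_rule)
  show ?thesis by (rule ILm_taut3[OF assms 1 2]) (unfold tval.simps, blast)
qed

lemma Rhd_left_cong:
  assumes "\<^bold>\<box> \<^bold>\<not> A \<^bold>\<longrightarrow> (A \<^bold>\<longleftrightarrow> B) \<in> L"
  shows "((A \<^bold>\<rhd> C) \<^bold>\<longleftrightarrow> (B \<^bold>\<rhd> C)) \<in> L"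
proof -
  let ?A = "A \<^bold>\<and> \<^bold>\<box> \<^bold>\<not> A" and ?B = "B \<^bold>\<and> \<^bold>\<box> \<^bold>\<not> B"
  note last = last_cong[OF assms]
  have 1: "(?A \<^bold>\<rhd> C) \<^bold>\<longrightarrow> (?B \<^bold>\<rhd> C) \<in> L"
    by (rule ILm.R2[OF ILm_taut1[OF last]]) (unfold tval.simps, blast)
  have 2: "(?B \<^bold>\<rhd> C) \<^bold>\<longrightarrow> (?A \<^bold>\<rhd> C) \<in> L"
    by (rule ILm.R2[OF ILm_taut1[OF last]]) (unfold tval.simps, blast)
  show ?thesis
    by (rule ILm_taut4[OF 1 2 Rhd_left_last[of A C] Rhd_left_last[of B C]]) (unfold tval.simps, blast)
qed

lemma Rhd_right_cong:
  assumes "\<^bold>\<box> \<^bold>\<not> A \<^bold>\<longrightarrow> (A \<^bold>\<longleftrightarrow> B) \<in> L"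
  shows "((C \<^bold>\<rhd> A) \<^bold>\<longleftrightarrow> (C \<^bold>\<rhd> B)) \<in> L"
proof -
  let ?A = "A \<^bold>\<and> \<^bold>\<box> \<^bold>\<not> A" and ?B = "B \<^bold>\<and> \<^bold>\<box> \<^bold>\<not> B"
  note last = last_cong[OF assms]
  have 1: "(C \<^bold>\<rhd> ?A) \<^bold>\<longrightarrow> (C \<^bold>\<rhd> ?B) \<in> L"
    by (rule ILm.R1[OF ILm_taut1[OF last]]) (unfold tval.simps, blast)
  have 2: "(C \<^bold>\<rhd> ?B) \<^bold>\<longrightarrow> (C \<^bold>\<rhd> ?A) \<in> L"
    by (rule ILm.R1[OF ILm_taut1[OF last]]) (unfold tval.simps, blast)
  show ?thesis
    by (rule ILm_taut4[OF 1 2 Rhd_right_last[of C A] Rhd_right_last[of C B]]) (unfold tval.simps, blast)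
qed

section \<open>Substitution\<close>

lemma subst_fresh: "p \<notin> vars A \<Longrightarrow> subst p F A = A"
  by (induction A) auto

lemma vars_subst: "vars (subst p F A) \<subseteq> (vars A - {p}) \<union> vars F"
  by (induction A) auto

lemma finite_vars: "finite (vars A)"
  by (induction A) auto

lemma subst_subst:
  assumes "p \<noteq> q" "p \<notin> vars C"
  shows "subst q C (subst p B A) = subst p (subst q C B) (subst q C A)"
  using assms by (induction A) (auto simp: subst_fresh)

text \<open>Substitution amounts to changing the valuation of the atoms, modal ones included. Hence
  tautologies are closed under substitution.\<close>

lemma tval_subst: "tval e (subst p F A) = tval (\<lambda>X. tval e (subst p F X)) A"
  by (induction A) auto

lemma subst_ILm:
  assumes "A \<in> ILm S" "subst p F ` S \<subseteq> S"
  shows "subst p F A \<in> ILm S"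
  using assms(1)
proof (induction rule: ILm.induct)
  case (Ax A)
  then show ?case using assms(2) by (blast intro: ILm.Ax)
next
  case (L1 A)
  then show ?case by (intro ILm.L1) (simp add: tautology_def tval_subst[of _ p F A])
next
  case (MP A B)
  then show ?case by (auto intro: ILm.MP)
qed (simp_all add: ILm.L2 ILm.L3 ILm.J3 ILm.J6 ILm.Nec ILm.R1 ILm.R2)

lemma subst_L:
  assumes "A \<in> L"
  shows "subst p F A \<in> L"
proof (rule subst_ILm[OF assms])
  show "subst p F ` (J2_plus \<union> J5) \<subseteq> J2_plus \<union> J5"
    unfolding J2_plus_def J5_def by fastforce
qed

text \<open>The plain equivalence serves occurrences outside modal operators, the boxed one those
  inside. In the modal cases the induction hypothesis is itself boxed, and \<open>Box_4\<close>
  supplies the doubly boxed premise.\<close>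

lemma subst_cong_Box:
  "(C \<^bold>\<longleftrightarrow> D) \<^bold>\<longrightarrow> \<^bold>\<box> (C \<^bold>\<longleftrightarrow> D) \<^bold>\<longrightarrow> (subst p C A \<^bold>\<longleftrightarrow> subst p D A) \<in> L"
proof (induction A)
  case Bot
  show ?case by (rule ILm.L1) (simp add: tautology_def)
next
  case (Var q)
  show ?case by (rule ILm.L1) (simp add: tautology_def)
next
  case (Imp A B)
  show ?case by (rule ILm_taut2[OF Imp.IH]) (unfold subst.simps tval.simps, blast)
next
  case (Box A)
  let ?X = "C \<^bold>\<longleftrightarrow> D" and ?A = "subst p C A" and ?A' = "subst p D A"
  have eq: "\<^bold>\<box> ?X \<^bold>\<longrightarrow> \<^bold>\<box> (?A \<^bold>\<longleftrightarrow> ?A') \<in> L"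
    by (rule ILm_taut2[OF Box_mono2[OF Box.IH] Box_4[of ?X]]) (unfold tval.simps, blast)
  have 1: "\<^bold>\<box> (?A \<^bold>\<longleftrightarrow> ?A') \<^bold>\<longrightarrow> \<^bold>\<box> ?A \<^bold>\<longrightarrow> \<^bold>\<box> ?A' \<in> L"
    by (intro Box_mono2 ILm.L1) (simp add: tautology_def)
  have 2: "\<^bold>\<box> (?A \<^bold>\<longleftrightarrow> ?A') \<^bold>\<longrightarrow> \<^bold>\<box> ?A' \<^bold>\<longrightarrow> \<^bold>\<box> ?A \<in> L"
    by (intro Box_mono2 ILm.L1) (simp add: tautology_def)
  show ?case by (rule ILm_taut3[OF eq 1 2]) (unfold subst.simps tval.simps, blast)
next
  case (Rhd A B)
  let ?X = "C \<^bold>\<longleftrightarrow> D"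
  have imps: "\<^bold>\<box> ?X \<^bold>\<longrightarrow> \<^bold>\<box> (E \<^bold>\<longrightarrow> E') \<in> L" "\<^bold>\<box> ?X \<^bold>\<longrightarrow> \<^bold>\<box> (E' \<^bold>\<longrightarrow> E) \<in> L"
    if "?X \<^bold>\<longrightarrow> \<^bold>\<box> ?X \<^bold>\<longrightarrow> (E \<^bold>\<longleftrightarrow> E') \<in> L" for E E'
  proof -
    have 1: "?X \<^bold>\<longrightarrow> \<^bold>\<box> ?X \<^bold>\<longrightarrow> (E \<^bold>\<longrightarrow> E') \<in> L"
      by (rule ILm_taut1[OF that]) (unfold tval.simps, blast)
    have 2: "?X \<^bold>\<longrightarrow> \<^bold>\<box> ?X \<^bold>\<longrightarrow> (E' \<^bold>\<longrightarrow> E) \<in> L"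
      by (rule ILm_taut1[OF that]) (unfold tval.simps, blast)
    show "\<^bold>\<box> ?X \<^bold>\<longrightarrow> \<^bold>\<box> (E \<^bold>\<longrightarrow> E') \<in> L"
      by (rule ILm_taut2[OF Box_mono2[OF 1] Box_4[of ?X]]) (unfold tval.simps, blast)
    show "\<^bold>\<box> ?X \<^bold>\<longrightarrow> \<^bold>\<box> (E' \<^bold>\<longrightarrow> E) \<in> L"
      by (rule ILm_taut2[OF Box_mono2[OF 2] Box_4[of ?X]]) (unfold tval.simps, blast)
  qed
  let ?A = "subst p C A" and ?A' = "subst p D A"
  let ?B = "subst p C B" and ?B' = "subst p D B"
  have 1: "\<^bold>\<box> ?X \<^bold>\<longrightarrow> (?A \<^bold>\<rhd> ?B) \<^bold>\<longrightarrow> (?A' \<^bold>\<rhd> ?B') \<in> L"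
    by (rule ILm_taut4[OF imps(2)[OF Rhd.IH(1)] imps(1)[OF Rhd.IH(2)]
          Rhd_left_Box[of ?A' ?A ?B] Rhd_right_Box[of ?B ?B' ?A']])
          (unfold tval.simps, blast)
  have 2: "\<^bold>\<box> ?X \<^bold>\<longrightarrow> (?A' \<^bold>\<rhd> ?B') \<^bold>\<longrightarrow> (?A \<^bold>\<rhd> ?B) \<in> L"
    by (rule ILm_taut4[OF imps(1)[OF Rhd.IH(1)] imps(2)[OF Rhd.IH(2)]
          Rhd_left_Box[of ?A ?A' ?B'] Rhd_right_Box[of ?B' ?B ?A]])
          (unfold tval.simps, blast)
  show ?case by (rule ILm_taut2[OF 1 2]) (unfold subst.simps tval.simps, blast)
qed

lemma subst_cong:
  assumes "(C \<^bold>\<longleftrightarrow> D) \<in> L"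
  shows "(subst p C A \<^bold>\<longleftrightarrow> subst p D A) \<in> L"
  by (rule ILm_taut3[OF assms ILm.Nec[OF assms] subst_cong_Box[of C D p A]])
    (unfold tval.simps, blast)

section \<open>Fixed points\<close>

lemma Rhd_fixed_point:
  fixes p A B
  defines "T \<equiv> \<^bold>\<not> \<^bold>\<bottom>"
  defines "E \<equiv> \<^bold>\<box> \<^bold>\<not> subst p T A"
  defines "D \<equiv> subst p T A \<^bold>\<rhd> subst p E B"
  shows "(D \<^bold>\<longleftrightarrow> (subst p D A \<^bold>\<rhd> subst p D B)) \<in> L"
proof -
  \<comment> \<open>Under \<open>E\<close> the left argument of \<open>D\<close> implies falsum, and
    falsum \<rhd>-reaches everything.\<close>
  have ED: "E \<^bold>\<longrightarrow> D \<in> L"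
  proof -
    have 1: "(\<^bold>\<bottom> \<^bold>\<rhd> subst p E B) \<in> L"
    proof -
      have "\<^bold>\<bottom> \<^bold>\<longrightarrow> \<^bold>\<not> \<^bold>\<not> \<^bold>\<bottom> \<in> L" by (rule ILm.L1) (simp add: tautology_def)
      moreover have "\<^bold>\<box> \<^bold>\<not> \<^bold>\<bottom> \<in> L" by (intro ILm.Nec ILm.L1) (simp add: tautology_def)
      moreover have "\<^bold>\<box> \<^bold>\<not> \<^bold>\<bottom> \<^bold>\<longrightarrow> (\<^bold>\<not> \<^bold>\<not> \<^bold>\<bottom> \<^bold>\<rhd> subst p E B) \<in> L" by (rule Box_imp_Neg_Rhd)
      ultimately show ?thesis by (blast intro: ILm.MP ILm.R2)
    qed
    show ?thesis unfolding E_def D_def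
      by (rule ILm_taut2[OF 1 Rhd_left_Box[of "subst p T A" "\<^bold>\<bottom>" "subst p E B"]])
        (unfold E_def tval.simps, blast)
  qed
  have "D \<^bold>\<longrightarrow> (T \<^bold>\<longleftrightarrow> D) \<in> L" by (rule ILm.L1) (simp add: tautology_def T_def)
  then have TD: "E \<^bold>\<longrightarrow> (T \<^bold>\<longleftrightarrow> D) \<in> L"
    by (rule ILm_taut2[OF _ ED]) (unfold tval.simps, blast)
  \<comment> \<open>\<open>E\<close> is a boxed formula, so whatever it implies it also implies
    boxed, as \<open>subst_cong_Box\<close> demands.\<close>
  have "E \<^bold>\<longrightarrow> \<^bold>\<box> (T \<^bold>\<longleftrightarrow> D) \<in> L"
    using Box_lift[OF TD[unfolded E_def]] by (simp add: E_def)
  then have "\<^bold>\<box> \<^bold>\<not> subst p T A \<^bold>\<longrightarrow> (subst p T A \<^bold>\<longleftrightarrow> subst p D A) \<in> L"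
    by (rule ILm_taut3[OF TD _ subst_cong_Box[of T D p A]])
      (unfold E_def tval.simps, blast)
  then have left: "((subst p T A \<^bold>\<rhd> subst p E B) \<^bold>\<longleftrightarrow> (subst p D A \<^bold>\<rhd> subst p E B)) \<in> L"
    by (rule Rhd_left_cong)
  let ?N = "\<^bold>\<box> \<^bold>\<not> subst p E B"
  \<comment> \<open>Under \<open>?N\<close> the right argument of \<open>D\<close> may be replaced
    by falsum, and J6 reads the result as \<open>E\<close>.\<close>
  have DE: "?N \<^bold>\<longrightarrow> D \<^bold>\<longrightarrow> E \<in> L"
  proof -
    have 1: "(subst p T A \<^bold>\<rhd> \<^bold>\<bottom>) \<^bold>\<longrightarrow> E \<in> L"
    proof -
      have "\<^bold>\<not> \<^bold>\<not> subst p T A \<^bold>\<longrightarrow> subst p T A \<in> L" by (rule ILm.L1) (simp add: tautology_def)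
      then have "(subst p T A \<^bold>\<rhd> \<^bold>\<bottom>) \<^bold>\<longrightarrow> (\<^bold>\<not> \<^bold>\<not> subst p T A \<^bold>\<rhd> \<^bold>\<bottom>) \<in> L" by (rule ILm.R2)
      then show ?thesis
        by (rule ILm_taut2[OF _ ILm.J6[of "\<^bold>\<not> subst p T A"]])
          (unfold E_def tval.simps, blast)
    qed
    show ?thesis unfolding D_def
      by (rule ILm_taut2[OF 1 Rhd_right_Box[of "subst p E B" "\<^bold>\<bottom>" "subst p T A"]])
        (unfold tval.simps, blast)
  qed
  have eq: "?N \<^bold>\<longrightarrow> (E \<^bold>\<longleftrightarrow> D) \<in> L" by (rule ILm_taut2[OF DE ED]) (unfold tval.simps, blast)
  have "?N \<^bold>\<longrightarrow> (subst p E B \<^bold>\<longleftrightarrow> subst p D B) \<in> L"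
    by (rule ILm_taut3[OF eq Box_lift[OF eq] subst_cong_Box[of E D p B]])
      (unfold tval.simps, blast)
  then have right: "((subst p D A \<^bold>\<rhd> subst p E B) \<^bold>\<longleftrightarrow> (subst p D A \<^bold>\<rhd> subst p D B)) \<in> L"
    by (rule Rhd_right_cong)
  show ?thesis by (rule ILm_taut2[OF left right]) (unfold D_def tval.simps, blast)
qed

lemma ex_Rhd_fixed_point:
  "\<exists>F. vars F \<subseteq> vars (A \<^bold>\<rhd> B) - {p} \<and> (F \<^bold>\<longleftrightarrow> (subst p F A \<^bold>\<rhd> subst p F B)) \<in> L"
proof (intro exI conjI)
  let ?T = "\<^bold>\<not> \<^bold>\<bottom>"
  let ?E = "\<^bold>\<box> \<^bold>\<not> subst p ?T A"
  let ?D = "subst p ?T A \<^bold>\<rhd> subst p ?E B"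
  show "vars ?D \<subseteq> vars (A \<^bold>\<rhd> B) - {p}"
    using vars_subst[of p ?T A] vars_subst[of p ?E B] by auto
  show "(?D \<^bold>\<longleftrightarrow> (subst p ?D A \<^bold>\<rhd> subst p ?D B)) \<in> L" by (rule Rhd_fixed_point)
qed

text \<open>J6 rewrites the box as a \<rhd>-formula whose right argument, falsum, is unaffected by
  substitution.\<close>

lemma ex_Box_fixed_point:
  "\<exists>F. vars F \<subseteq> vars (\<^bold>\<box> A) - {p} \<and> (F \<^bold>\<longleftrightarrow> \<^bold>\<box> (subst p F A)) \<in> L"
proof -
  obtain F where F: "vars F \<subseteq> vars A - {p}"
    and fp: "(F \<^bold>\<longleftrightarrow> (\<^bold>\<not> subst p F A \<^bold>\<rhd> \<^bold>\<bottom>)) \<in> L"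
    using ex_Rhd_fixed_point[of "\<^bold>\<not> A" "\<^bold>\<bottom>" p] by auto
  have "(F \<^bold>\<longleftrightarrow> \<^bold>\<box> (subst p F A)) \<in> L"
    by (rule ILm_taut2[OF fp ILm.J6[of "subst p F A"]]) (unfold tval.simps, blast)
  then show ?thesis using F by auto
qed

section \<open>Elimination of outermost modal subformulas\<close>

primrec modal :: "fm \<Rightarrow> bool" where
  "modal \<^bold>\<bottom> = False"
| "modal (Var q) = False"
| "modal (A \<^bold>\<longrightarrow> B) = False"
| "modal (\<^bold>\<box> A) = True"
| "modal (A \<^bold>\<rhd> B) = True"

lemma ex_modal_fixed_point:
  assumes "modal M"
  shows "\<exists>F. vars F \<subseteq> vars M - {p} \<and> (F \<^bold>\<longleftrightarrow> subst p F M) \<in> L"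
  using assms ex_Box_fixed_point ex_Rhd_fixed_point by (cases M) simp_all

text \<open>The induction measure of the main theorem: outermost modal occurrences containing
  \<open>p\<close>, counted with repetition and ignoring nested ones.\<close>

primrec modal_count :: "nat \<Rightarrow> fm \<Rightarrow> nat" where
  "modal_count p \<^bold>\<bottom> = 0"
| "modal_count p (Var q) = 0"
| "modal_count p (A \<^bold>\<longrightarrow> B) = modal_count p A + modal_count p B"
| "modal_count p (\<^bold>\<box> A) = (if p \<in> vars A then 1 else 0)"
| "modal_count p (A \<^bold>\<rhd> B) = (if p \<in> vars A \<union> vars B then 1 else 0)"

lemma modal_count_eq_0: "modalized p A \<Longrightarrow> modal_count p A = 0 \<Longrightarrow> p \<notin> vars A"
  by (induction A) (auto split: if_splits)

text \<open>A single occurrence is replaced by the fresh \<open>q\<close>, so the count drops by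
  exactly one even if \<open>M\<close> occurs elsewhere.\<close>

lemma extract_modal:
  assumes "modalized p A" "modal_count p A = Suc n" "q \<notin> vars A" "q \<noteq> p"
  shows "\<exists>A' M. A = subst q M A' \<and> modal_count p A' = n \<and> modalized p A' \<and>
    vars A' \<subseteq> insert q (vars A) \<and> vars M \<subseteq> vars A \<and> modal M"
  using assms
proof (induction A arbitrary: n)
  case (Imp A B)
  show ?case
  proof (cases "modal_count p A")
    \<comment> \<open>The occurrence to extract lies in \<open>B\<close>; \<open>A\<close> is free
      of \<open>q\<close>, so substituting \<open>M\<close> back leaves it alone.\<close>
    case 0
    then obtain B' M where "B = subst q M B'" "modal_count p B' = n" "modalized p B'"
      "vars B' \<subseteq> insert q (vars B)" "vars M \<subseteq> vars B" "modal M"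
      using Imp by force
    then show ?thesis using 0 Imp.prems
      by (intro exI[of _ "A \<^bold>\<longrightarrow> B'"] exI[of _ M]) (auto simp: subst_fresh)
  next
    case (Suc m)
    then obtain A' M where "A = subst q M A'" "modal_count p A' = m" "modalized p A'"
      "vars A' \<subseteq> insert q (vars A)" "vars M \<subseteq> vars A" "modal M"
      using Imp by force
    then show ?thesis using Suc Imp.prems
      by (intro exI[of _ "A' \<^bold>\<longrightarrow> B"] exI[of _ M]) (auto simp: subst_fresh)
  qed
next
  case (Box A)
  then show ?case
    by (intro exI[of _ "Var q"] exI[of _ "\<^bold>\<box> A"]) (auto split: if_splits)
next
  case (Rhd A B)
  then show ?case
    by (intro exI[of _ "Var q"] exI[of _ "A \<^bold>\<rhd> B"]) (auto split: if_splits)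
qed simp_all

theorem corollary5p1:
  fixes p :: nat and A :: fm
  assumes "modalized p A"
  shows "\<exists>F. vars F \<subseteq> vars A - {p} \<and> (F \<^bold>\<longleftrightarrow> subst p F A) \<in> ILm (J2_plus \<union> J5)"
  using assms
proof (induction "modal_count p A" arbitrary: A)
  case 0
  then have "p \<notin> vars A" using modal_count_eq_0 by simp
  moreover have "(A \<^bold>\<longleftrightarrow> A) \<in> L" by (rule ILm.L1) (simp add: tautology_def)
  ultimately show ?case by (intro exI[of _ A]) (simp add: subst_fresh)
next
  case (Suc n)
  obtain q where q: "q \<notin> vars A" "q \<noteq> p"
    using ex_new_if_finite[OF infinite_UNIV_nat, of "insert p (vars A)"] finite_vars by auto
  obtain A' M where A': "A = subst q M A'" "modal_count p A' = n" "modalized p A'"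
    "vars A' \<subseteq> insert q (vars A)" and M: "vars M \<subseteq> vars A" "modal M"
    using extract_modal[OF Suc.prems Suc.hyps(2)[symmetric] q] by blast
  \<comment> \<open>Here \<open>q\<close> is a parameter and may occur in \<open>F\<close>.\<close>
  obtain F where F: "vars F \<subseteq> vars A' - {p}" "(F \<^bold>\<longleftrightarrow> subst p F A') \<in> L"
    using Suc.hyps(1)[OF A'(2)[symmetric] A'(3)] by blast
  \<comment> \<open>Substitution keeps the outermost operator, so the equation for \<open>q\<close>
    is again of modal form.\<close>
  have "modal (subst p F M)" using M(2) by (cases M) simp_all
  then obtain G where G: "vars G \<subseteq> vars (subst p F M) - {q}"
    "(G \<^bold>\<longleftrightarrow> subst q G (subst p F M)) \<in> L"
    using ex_modal_fixed_point by blast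
  define H where "H = subst q G F"
  have vG: "vars G \<subseteq> vars A - {p}"
    using G(1) vars_subst[of p F M] M(1) F(1) A'(4) by blast
  then have vH: "vars H \<subseteq> vars A - {p}"
    using vars_subst[of q G F] F(1) A'(4) unfolding H_def by blast
  have pG: "p \<notin> vars G" and qM: "q \<notin> vars M" and qH: "q \<notin> vars H"
    using vG vH M(1) q(1) by auto
  have push: "subst q G (subst p F B) = subst p H (subst q G B)" for B
    using subst_subst[of p q G F B] pG q(2) by (simp add: H_def)
  have pull: "subst p H (subst q B A') = subst q (subst p H B) (subst p H A')" for B
    using subst_subst[of q p H B A'] qH q(2) by simp
  \<comment> \<open>Instantiate \<open>q\<close> by \<open>G\<close> in the fixed point equation of
    \<open>F\<close>.\<close>
  have "(H \<^bold>\<longleftrightarrow> subst p H (subst q G A')) \<in> L"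
    using subst_L[OF F(2), of q G] by (simp add: H_def push)
  then have 1: "(H \<^bold>\<longleftrightarrow> subst q G (subst p H A')) \<in> L"
    using pull[of G] pG by (simp add: subst_fresh)
  \<comment> \<open>Since \<open>q\<close> is not in \<open>M\<close>, the equation for
    \<open>G\<close> involves \<open>F\<close> only through \<open>H\<close>.\<close>
  have "(G \<^bold>\<longleftrightarrow> subst p H M) \<in> L" using G(2) qM by (simp add: push subst_fresh)
  \<comment> \<open>Replacing \<open>G\<close> by \<open>M(H)\<close> at the place of
    \<open>q\<close> restores the extracted subformula and turns \<open>A'\<close> back into
    \<open>A\<close>.\<close>
  then have 2: "(subst q G (subst p H A') \<^bold>\<longleftrightarrow> subst p H A) \<in> L"
    using subst_cong pull[of M] A'(1) by simp
  have "(H \<^bold>\<longleftrightarrow> subst p H A) \<in> L" by (rule ILm_taut2[OF 1 2]) (unfold tval.simps, blast)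
  then show ?case using vH by blast
qed

end
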